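(* Let $(X,X_+,\mathcal{K},f)$ be an abstract state space, let $T:X\to X$ be a Markov operator and let $P:X\to X$ be a bounded linear projection ($P^2=P$). If $T$ is uniformly $P$-ergodic, i.e. $\lim_{n\to\infty}\|T^n-P\|=0$, then $\beta^*=r(T-P)$, where $$\beta^*=\sup\{|\lambda| : \lambda\in\sigma(T),\ \lambda\neq 1\}.$$
   Context: Abstract state space: let $X\neq\{0\}$ be a real ordered vector space with cone $X_+=\{x\in X: x\ge 0\}$ which is generating ($X=X_+-X_+$), let $f$ be a strictly positive linear functional on $X$ ($f(x)>0$ for $x\ge 0$, $x\ne 0$), and let $\mathcal{K}=\{x\in X_+: f(x)=1\}$. Let $U$ be the convex hull of $\mathcal{K}\cup(-\mathcal{K})$ and $\|x\|=\inf\{\lambda\ge 0: x\in\lambda U\}$. $(X,X_+,\mathcal{K},f)$ is an abstract state space if this seminorm is a norm, $X$ is complete for it, and $X_+$ is closed. A Markov operator on $X$ is a linear operator $T:X\to X$ that is positive ($Tx\ge0$ for $x\ge0$) and satisfies $T(\mathcal{K})\subset\mathcal{K}$. Complexification: spectral notions are taken over $\mathbb{C}$. That is, $X$ is replaced by $\tilde X=X+iX$ with norm $\|x+iy\|_\infty=\sup_{0\le t\le 2\pi}\|x\cos t-y\sin t\|$, and a bounded operator $T$ on $X$ by its extension $x+iy\mapsto Tx+iTy$ (which has the same norm). $\sigma(T)$ is the set of $\lambda\in\mathbb{C}$ such that $\lambda I-T$ does not have a continuous inverse, and $r(T)=\sup_{\lambda\in\sigma(T)}|\lambda|$ is the spectral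 radius. In the degenerate case $P=I$ (so $T=I$), the supremum of the empty set is taken to be $0$. *)

theory Defs
  imports "HOL-Analysis.Analysis"
begin

section \<open>Abstract state spaces\<close>

text \<open>The cone is the set of nonnegative elements of the ordered vector space, so only the
  functional is a parameter.\<close>

definition state_base :: "('a::ordered_real_vector \<Rightarrow> real) \<Rightarrow> 'a set"
  where "state_base f = {x. 0 \<le> x \<and> f x = 1}"

definition base_ball :: "('a::ordered_real_vector \<Rightarrow> real) \<Rightarrow> 'a set"
  where "base_ball f = convex hull (state_base f \<union> uminus ` state_base f)"

definition base_seminorm :: "('a::ordered_real_vector \<Rightarrow> real) \<Rightarrow> 'a \<Rightarrow> real"
  where "base_seminorm f x = Inf {l. 0 \<le> l \<and> x \<in> (\<lambda>u. l *\<^sub>R u) ` base_ball f}"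

text \<open>That the seminorm is a norm for which the space is complete is expressed by requiring it
  to be the norm of a type of class \<^class>\<open>banach\<close>; in particular "closed" refers to the topology
  it induces.\<close>

locale abstract_state_space =
  fixes f :: "'a::{ordered_real_vector,banach} \<Rightarrow> real"
  assumes nontrivial: "\<exists>x::'a. x \<noteq> 0"
    and generating: "\<forall>x::'a. \<exists>y z. 0 \<le> y \<and> 0 \<le> z \<and> x = y - z"
    and linear_functional: "linear f"
    and strictly_positive: "\<forall>x. 0 \<le> x \<and> x \<noteq> 0 \<longrightarrow> 0 < f x"
    and norm_eq: "\<forall>x. norm x = base_seminorm f x"
    and closed_cone: "closed {x::'a. 0 \<le> x}"

definition markov_operator ::
    "('a::ordered_real_vector \<Rightarrow> real) \<Rightarrow> ('a \<Rightarrow> 'a) \<Rightarrow> bool"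
  where "markov_operator f T \<longleftrightarrow>
    linear T \<and> (\<forall>x. 0 \<le> x \<longrightarrow> 0 \<le> T x) \<and> T ` state_base f \<subseteq> state_base f"

definition bounded_projection :: "('a::real_normed_vector \<Rightarrow> 'a) \<Rightarrow> bool"
  where "bounded_projection P \<longleftrightarrow> bounded_linear P \<and> P \<circ> P = P"

text \<open>\<^const>\<open>onorm\<close> is only meaningful for bounded operators; here boundedness is automatic, since
  a Markov operator on an abstract state space is a contraction.\<close>

definition uniformly_ergodic :: "('a::real_normed_vector \<Rightarrow> 'a) \<Rightarrow> ('a \<Rightarrow> 'a) \<Rightarrow> bool"
  where "uniformly_ergodic T P \<longleftrightarrow> (\<lambda>n. onorm (\<lambda>x. (T ^^ n) x - P x)) \<longlonglongrightarrow> 0"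


section \<open>Complexification\<close>

text \<open>\<open>Cx x y\<close> stands for \<open>x + iy\<close>.\<close>

datatype 'a complexification = Cx (re_part: 'a) (im_part: 'a)

instantiation complexification :: (real_vector) real_vector
begin

definition "0 = Cx 0 0"
definition "z + w = Cx (re_part z + re_part w) (im_part z + im_part w)"
definition "- z = Cx (- re_part z) (- im_part z)"
definition "z - w = Cx (re_part z - re_part w) (im_part z - im_part w)"
definition "r *\<^sub>R z = Cx (r *\<^sub>R re_part z) (r *\<^sub>R im_part z)"

instance
  by standard
    (simp_all add: zero_complexification_def plus_complexification_def
      uminus_complexification_def minus_complexification_def scaleR_complexification_def
      algebra_simps)

end

definition scaleCx :: "complex \<Rightarrow> 'a::real_vector complexification \<Rightarrow> 'a complexification"
  where "scaleCx c z = Cx (Re c *\<^sub>R re_part z - Im c *\<^sub>R im_part z)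
                          (Re c *\<^sub>R im_part z + Im c *\<^sub>R re_part z)"

lemma bdd_above_rotated_norms:
  fixes x y :: "'a::real_normed_vector"
  shows "bdd_above ((\<lambda>t. norm (cos t *\<^sub>R x - sin t *\<^sub>R y)) ` A)"
proof (rule bdd_aboveI2)
  fix t :: real
  have "norm (cos t *\<^sub>R x - sin t *\<^sub>R y) \<le> \<bar>cos t\<bar> * norm x + \<bar>sin t\<bar> * norm y"
    using norm_triangle_ineq4[of "cos t *\<^sub>R x" "sin t *\<^sub>R y"] by simp
  also have "\<dots> \<le> 1 * norm x + 1 * norm y"
    by (intro add_mono mult_right_mono) auto
  finally show "norm (cos t *\<^sub>R x - sin t *\<^sub>R y) \<le> norm x + norm y" by simp
qed

instantiation complexification :: (real_normed_vector) real_normed_vector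
begin

definition norm_complexification :: "'a complexification \<Rightarrow> real"
  where "norm_complexification z = (SUP t\<in>{0..2*pi}. norm (cos t *\<^sub>R re_part z - sin t *\<^sub>R im_part z))"

definition dist_complexification :: "'a complexification \<Rightarrow> 'a complexification \<Rightarrow> real"
  where "dist_complexification z w = norm (z - w)"

definition sgn_complexification :: "'a complexification \<Rightarrow> 'a complexification"
  where "sgn_complexification z = inverse (norm z) *\<^sub>R z"

definition uniformity_complexification :: "('a complexification \<times> 'a complexification) filter"
  where "uniformity_complexification = (INF e\<in>{0<..}. principal {(x, y). dist x y < e})"

definition open_complexification :: "'a complexification set \<Rightarrow> bool"
  where "open_complexification U \<longleftrightarrow> (\<forall>x\<in>U. \<forall>\<^sub>F (x', y) in uniformity. x' = x \<longrightarrow> y \<in> U)"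

instance
proof
  fix z w :: "'a complexification" and r :: real
  have upper: "norm (cos t *\<^sub>R re_part u - sin t *\<^sub>R im_part u) \<le> norm u"
    if "t \<in> {0..2*pi}" for t and u :: "'a complexification"
    unfolding norm_complexification_def
    by (rule cSUP_upper[OF that bdd_above_rotated_norms])
  have ne: "{0..2*pi} \<noteq> {}" by simp
  show "norm z = 0 \<longleftrightarrow> z = 0"
  proof
    assume n: "norm z = 0"
    have "re_part z = 0" using upper[of 0 z] n by simp
    moreover have "im_part z = 0" using upper[of "pi/2" z] n by simp
    ultimately show "z = 0" by (cases z) (simp add: zero_complexification_def)
  next
    assume "z = 0"
    then show "norm z = 0" by (simp add: norm_complexification_def zero_complexification_def)
  qed
  show "norm (z + w) \<le> norm z + norm w"
    unfolding norm_complexification_def[of "z + w"]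
  proof (rule cSUP_least[OF ne])
    fix t :: real assume t: "t \<in> {0..2*pi}"
    have "cos t *\<^sub>R re_part (z + w) - sin t *\<^sub>R im_part (z + w)
      = (cos t *\<^sub>R re_part z - sin t *\<^sub>R im_part z) + (cos t *\<^sub>R re_part w - sin t *\<^sub>R im_part w)"
      by (simp add: plus_complexification_def algebra_simps)
    then show "norm (cos t *\<^sub>R re_part (z + w) - sin t *\<^sub>R im_part (z + w)) \<le> norm z + norm w"
      using norm_triangle_le[OF add_mono[OF upper[OF t, of z] upper[OF t, of w]]]
      by (simp only:)
  qed
  have scale: "norm (s *\<^sub>R u) \<le> \<bar>s\<bar> * norm u" for s and u :: "'a complexification"
    unfolding norm_complexification_def[of "s *\<^sub>R u"]
  proof (rule cSUP_least[OF ne])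
    fix t :: real assume t: "t \<in> {0..2*pi}"
    have "cos t *\<^sub>R re_part (s *\<^sub>R u) - sin t *\<^sub>R im_part (s *\<^sub>R u)
      = s *\<^sub>R (cos t *\<^sub>R re_part u - sin t *\<^sub>R im_part u)"
      by (simp add: scaleR_complexification_def algebra_simps)
    then show "norm (cos t *\<^sub>R re_part (s *\<^sub>R u) - sin t *\<^sub>R im_part (s *\<^sub>R u)) \<le> \<bar>s\<bar> * norm u"
      using upper[OF t, of u] by (simp add: mult_left_mono)
  qed
  show "norm (r *\<^sub>R z) = \<bar>r\<bar> * norm z"
  proof (cases "r = 0")
    case True
    then show ?thesis
      by (simp add: norm_complexification_def zero_complexification_def)
  next
    case False
    have "\<bar>r\<bar> * norm z = \<bar>r\<bar> * norm (inverse r *\<^sub>R (r *\<^sub>R z))" using False by simp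
    also have "\<dots> \<le> \<bar>r\<bar> * (\<bar>inverse r\<bar> * norm (r *\<^sub>R z))"
      by (intro mult_left_mono scale) simp
    also have "\<dots> = norm (r *\<^sub>R z)" using False by (simp add: abs_inverse)
    finally show ?thesis using scale[of r z] by simp
  qed
qed (rule dist_complexification_def sgn_complexification_def uniformity_complexification_def
      open_complexification_def)+

end

definition complexify ::
    "('a \<Rightarrow> 'a) \<Rightarrow> 'a complexification \<Rightarrow> 'a complexification"
  where "complexify T z = Cx (T (re_part z)) (T (im_part z))"


section \<open>Spectral notions\<close>

definition spectrum :: "('a::real_normed_vector \<Rightarrow> 'a) \<Rightarrow> complex set"
  where "spectrum T = {c. \<not> (let R = (\<lambda>z. scaleCx c z - complexify T z)
                            in bij R \<and> continuous_on UNIV (inv R))}"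

text \<open>Supremum in \<open>[0, \<infinity>)\<close>, so that the supremum of the empty set is 0
  (\<^term>\<open>Sup {} :: real\<close> is unspecified).\<close>

definition nonneg_Sup :: "real set \<Rightarrow> real"
  where "nonneg_Sup A = (if A = {} then 0 else Sup A)"

definition spectral_radius :: "('a::real_normed_vector \<Rightarrow> 'a) \<Rightarrow> real"
  where "spectral_radius T = nonneg_Sup {cmod c | c. c \<in> spectrum T}"

definition beta_star :: "('a::real_normed_vector \<Rightarrow> 'a) \<Rightarrow> real"
  where "beta_star T = nonneg_Sup {cmod c | c. c \<in> spectrum T \<and> c \<noteq> 1}"

end

theory Submission
  imports Defs
begin

text \<open>Norm convergence \<open>T^n \<rightarrow> P\<close> forces \<open>T P = P T = P\<close>, so with \<open>Q = T - P\<close> we have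
  \<open>Q P = P Q = 0\<close> and \<open>Q^n = T^n - P \<rightarrow> 0\<close>; in particular \<open>1 - Q\<close> is invertible by a Neumann
  argument. The operators \<open>\<lambda> - T\<close> and \<open>\<lambda> - Q\<close> agree on \<open>ker P\<close>, while on \<open>ran P\<close> they are
  multiplication by \<open>\<lambda> - 1\<close> and by \<open>\<lambda>\<close>; hence the spectra of \<open>T\<close> and \<open>Q\<close> coincide away
  from \<open>0\<close> and \<open>1\<close>. The point \<open>1\<close> is excluded on one side and regular on the other, and \<open>0\<close> does
  not influence the supremum.\<close>

section \<open>The complexification\<close>

lemma re_part_plus [simp]: "re_part (z + w) = re_part z + re_part w"
  and im_part_plus [simp]: "im_part (z + w) = im_part z + im_part w"
  by (simp_all add: plus_complexification_def)

lemma re_part_diff [simp]: "re_part (z - w) = re_part z - re_part w"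
  and im_part_diff [simp]: "im_part (z - w) = im_part z - im_part w"
  by (simp_all add: minus_complexification_def)

lemma re_part_zero [simp]: "re_part 0 = 0"
  and im_part_zero [simp]: "im_part 0 = 0"
  by (simp_all add: zero_complexification_def)

lemma re_part_scaleR [simp]: "re_part (r *\<^sub>R z) = r *\<^sub>R re_part z"
  and im_part_scaleR [simp]: "im_part (r *\<^sub>R z) = r *\<^sub>R im_part z"
  by (simp_all add: scaleR_complexification_def)

lemma re_part_scaleCx [simp]: "re_part (scaleCx c z) = Re c *\<^sub>R re_part z - Im c *\<^sub>R im_part z"
  and im_part_scaleCx [simp]: "im_part (scaleCx c z) = Re c *\<^sub>R im_part z + Im c *\<^sub>R re_part z"
  by (simp_all add: scaleCx_def)

lemma re_part_complexify [simp]: "re_part (complexify T z) = T (re_part z)"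
  and im_part_complexify [simp]: "im_part (complexify T z) = T (im_part z)"
  by (simp_all add: complexify_def)

lemma complexification_eqI:
  "re_part z = re_part w \<Longrightarrow> im_part z = im_part w \<Longrightarrow> z = w"
  by (rule complexification.expand) simp

lemma norm_rotated_le:
  fixes z :: "'a::real_normed_vector complexification"
  assumes "t \<in> {0..2*pi}"
  shows "norm (cos t *\<^sub>R re_part z - sin t *\<^sub>R im_part z) \<le> norm z"
  unfolding norm_complexification_def
  by (rule cSUP_upper[OF assms bdd_above_rotated_norms])

lemma norm_re_part_le: "norm (re_part z) \<le> norm z"
  using norm_rotated_le[of 0 z] by simp

lemma norm_im_part_le: "norm (im_part z) \<le> norm z"
  \<comment> \<open>At angle \<open>pi/2\<close> the rotated vector is the negative of the imaginary
    part.\<close>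
  using norm_rotated_le[of "pi/2" z] by simp

text \<open>Together with the bounds on the two parts, this makes the norm equivalent to the sum of
  the norms of the parts. Continuity of \<open>complexify T\<close> and \<open>scaleCx c\<close>
  rests on that equivalence.\<close>

lemma norm_Cx_le: "norm (Cx x y) \<le> norm x + norm y"
  unfolding norm_complexification_def
proof (rule cSUP_least)
  fix t :: real
  have "norm (cos t *\<^sub>R x - sin t *\<^sub>R y) \<le> \<bar>cos t\<bar> * norm x + \<bar>sin t\<bar> * norm y"
    using norm_triangle_ineq4[of "cos t *\<^sub>R x" "sin t *\<^sub>R y"] by simp
  also have "\<dots> \<le> 1 * norm x + 1 * norm y"
    by (intro add_mono mult_right_mono) auto
  finally show "norm (cos t *\<^sub>R re_part (Cx x y) - sin t *\<^sub>R im_part (Cx x y)) \<le> norm x + norm y"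
    by simp
qed simp

lemma bounded_linear_re_part: "bounded_linear re_part"
  by (rule bounded_linear_intro[where K = 1]) (simp_all add: norm_re_part_le)

lemma bounded_linear_im_part: "bounded_linear im_part"
  by (rule bounded_linear_intro[where K = 1]) (simp_all add: norm_im_part_le)

lemma bounded_linear_Cx:
  assumes "bounded_linear g" and "bounded_linear h"
  shows "bounded_linear (\<lambda>z. Cx (g z) (h z))"
proof -
  interpret g: bounded_linear g by fact
  interpret h: bounded_linear h by fact
  obtain K where K: "norm (g z) \<le> norm z * K" for z using g.bounded by blast
  obtain L where L: "norm (h z) \<le> norm z * L" for z using h.bounded by blast
  show ?thesis
  proof (rule bounded_linear_intro[where K = "K + L"])
    show "norm (Cx (g z) (h z)) \<le> norm z * (K + L)" for z
      using norm_Cx_le[of "g z" "h z"] K[of z] L[of z] by (simp add: algebra_simps)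
  qed (auto intro!: complexification_eqI simp: g.add h.add g.scaleR h.scaleR)
qed

lemma bounded_linear_complexify:
  assumes "bounded_linear T"
  shows "bounded_linear (complexify T)"
  unfolding complexify_def[abs_def]
  by (intro bounded_linear_Cx bounded_linear_compose[OF assms]
      bounded_linear_re_part bounded_linear_im_part)

lemma bounded_linear_scaleCx: "bounded_linear (scaleCx c)"
  unfolding scaleCx_def[abs_def]
  by (intro bounded_linear_Cx bounded_linear_sub bounded_linear_add
      bounded_linear_compose[OF bounded_linear_scaleR_right]
      bounded_linear_re_part bounded_linear_im_part)

lemma scaleCx_scaleCx: "scaleCx c (scaleCx d z) = scaleCx (c * d) z"
  by (rule complexification_eqI) (simp_all add: algebra_simps)

lemma scaleCx_one [simp]: "scaleCx 1 z = z"
  by (rule complexification_eqI) simp_all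

lemma scaleCx_zero_right [simp]: "scaleCx c 0 = 0"
  by (rule complexification_eqI) simp_all

lemma scaleCx_eq_0_iff: "scaleCx c z = 0 \<longleftrightarrow> c = 0 \<or> z = 0"
proof (cases "c = 0")
  case False
  then have "scaleCx (inverse c) (scaleCx c z) = z" by (simp add: scaleCx_scaleCx)
  with False show ?thesis by auto
next
  case True
  then show ?thesis by (auto intro: complexification_eqI)
qed

lemma complexify_scaleCx:
  assumes "linear T"
  shows "complexify T (scaleCx c z) = scaleCx c (complexify T z)"
  by (rule complexification_eqI)
    (simp_all add: linear_diff[OF assms] linear_add[OF assms] linear_scale[OF assms])


section \<open>Spectra\<close>

text \<open>Trades \<open>bij\<close> and \<open>inv\<close> for an explicit two-sided inverse, so
  that regularity of a point is shown by exhibiting \<open>G\<close> and used by obtaining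
  it.\<close>

lemma not_in_spectrum_iff:
  "c \<notin> spectrum T \<longleftrightarrow>
    (\<exists>G. continuous_on UNIV G \<and> (\<forall>z. scaleCx c (G z) - complexify T (G z) = z)
       \<and> (\<forall>z. G (scaleCx c z - complexify T z) = z))"
proof -
  define R where "R = (\<lambda>z. scaleCx c z - complexify T z)"
  have "c \<notin> spectrum T \<longleftrightarrow> bij R \<and> continuous_on UNIV (inv R)"
    by (simp add: spectrum_def R_def Let_def)
  also have "\<dots> \<longleftrightarrow> (\<exists>G. continuous_on UNIV G \<and> (\<forall>z. R (G z) = z) \<and> (\<forall>z. G (R z) = z))"
  proof
    assume "bij R \<and> continuous_on UNIV (inv R)"
    then show "\<exists>G. continuous_on UNIV G \<and> (\<forall>z. R (G z) = z) \<and> (\<forall>z. G (R z) = z)"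
      by (intro exI[of _ "inv R"])
        (simp add: bij_is_inj bij_is_surj surj_f_inv_f)
  next
    assume "\<exists>G. continuous_on UNIV G \<and> (\<forall>z. R (G z) = z) \<and> (\<forall>z. G (R z) = z)"
    then obtain G where G: "continuous_on UNIV G" "\<And>z. R (G z) = z" "\<And>z. G (R z) = z" by blast
    then have "bij R" by (intro o_bij[of G]) (auto simp: fun_eq_iff)
    moreover have "inv R = G" using G by (intro inv_equality)
    ultimately show "bij R \<and> continuous_on UNIV (inv R)" using G(1) by simp
  qed
  finally show ?thesis by (simp add: R_def)
qed

text \<open>The space splits into the kernel and the range of the projection, and an inverse is
  assembled from the two pieces. The scalars \<open>s\<close> and \<open>t\<close> are kept general
  so that the lemma can be applied in both directions between an operator and its perturbation by
  \<open>P\<close>.\<close>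

lemma not_in_spectrum_transfer:
  fixes S T P :: "'a::real_normed_vector \<Rightarrow> 'a" and s t :: real and c :: complex
  assumes S: "linear S" and T: "linear T" and P: "bounded_linear P"
    and PP: "\<And>x. P (P x) = P x"
    and SP: "\<And>x. P (S x) = s *\<^sub>R P x"
    and TP: "\<And>x. T (P x) = t *\<^sub>R P x" and PT: "\<And>x. P (T x) = t *\<^sub>R P x"
    and agree: "\<And>x. P x = 0 \<Longrightarrow> S x = T x"
    and c: "c \<noteq> s" "c \<noteq> t"
    and regular: "c \<notin> spectrum S"
  shows "c \<notin> spectrum T"
proof -
  define E where "E = complexify P"
  define A where "A = (\<lambda>z. scaleCx c z - complexify S z)"
  define B where "B = (\<lambda>z. scaleCx c z - complexify T z)"
  interpret P: bounded_linear P by fact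
  interpret E: bounded_linear E unfolding E_def by (rule bounded_linear_complexify[OF P])
  have B_add: "B (z + w) = B z + B w" and B_diff: "B (z - w) = B z - B w" for z w
    by (auto intro!: complexification_eqI
        simp: B_def linear_add[OF T] linear_diff[OF T] algebra_simps)
  obtain G where G: "continuous_on UNIV G" "\<And>z. A (G z) = z" "\<And>z. G (A z) = z"
    using regular unfolding not_in_spectrum_iff A_def by blast
  have EE: "E (E z) = E z" for z
    by (auto intro!: complexification_eqI simp: E_def PP)
  have EA: "E (A z) = scaleCx (c - s) (E z)" for z
    by (auto intro!: complexification_eqI
        simp: E_def A_def SP P.diff P.add P.scaleR algebra_simps)
  have EB: "E (B z) = scaleCx (c - t) (E z)" for z
    by (auto intro!: complexification_eqI
        simp: E_def B_def PT P.diff P.add P.scaleR algebra_simps)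
  have BE: "B (E z) = scaleCx (c - t) (E z)" for z
    by (auto intro!: complexification_eqI simp: E_def B_def TP algebra_simps)
  have AB: "A z = B z" if "E z = 0" for z
  proof -
    have "P (re_part z) = 0" "P (im_part z) = 0"
      using that by (auto simp: E_def complexify_def zero_complexification_def)
    then show ?thesis
      by (auto intro!: complexification_eqI simp: A_def B_def agree)
  qed
  have E_scale: "E (scaleCx d z) = scaleCx d (E z)" for d z
    unfolding E_def by (rule complexify_scaleCx[OF P.linear])
  have E_compl: "E (z - E z) = 0" for z by (simp add: E.diff EE)
  have inverse_scale: "scaleCx (inverse (c - t)) (scaleCx (c - t) z) = z"
    "scaleCx (c - t) (scaleCx (inverse (c - t)) z) = z" for z
    using c(2) by (simp_all add: scaleCx_scaleCx)
  \<comment> \<open>On the kernel of \<open>E\<close> the known inverse \<open>G\<close> serves; on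
    the range, \<open>B\<close> is multiplication by \<open>c - t\<close> and is inverted by
    division.\<close>
  define H where "H z = G (z - E z) + scaleCx (inverse (c - t)) (E z)" for z
  have "B (H z) = z" for z
  proof -
    \<comment> \<open>Applying \<open>E\<close> to \<open>A (G w) = w\<close> for \<open>w\<close>
      in the kernel of \<open>E\<close> shows that \<open>G\<close> preserves this kernel, where
      \<open>A\<close> and \<open>B\<close> agree.\<close>
    have "scaleCx (c - s) (E (G (z - E z))) = 0"
      using EA[of "G (z - E z)"] by (simp add: G(2) E_compl)
    then have "E (G (z - E z)) = 0" using c(1) by (simp add: scaleCx_eq_0_iff)
    then have "B (G (z - E z)) = z - E z" using AB G(2) by metis
    moreover have "B (scaleCx (inverse (c - t)) (E z)) = E z"
      using BE[of "scaleCx (inverse (c - t)) (E z)"]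
      by (simp add: E_scale EE inverse_scale)
    ultimately show ?thesis by (simp add: H_def B_add)
  qed
  moreover have "H (B z) = z" for z
  proof -
    \<comment> \<open>\<open>B\<close> commutes with \<open>E\<close>, so the kernel component of
      \<open>B z\<close> is \<open>B (z - E z)\<close>, and there \<open>B\<close> may be replaced
      by \<open>A\<close>, which \<open>G\<close> cancels.\<close>
    have "B z - E (B z) = A (z - E z)"
      by (simp add: AB[OF E_compl] B_diff BE EB)
    then show ?thesis by (simp add: H_def G(3) EB inverse_scale)
  qed
  moreover have "continuous_on UNIV H"
  proof -
    have E_cont: "continuous_on UNIV E" by (rule E.continuous_on[OF continuous_on_id])
    then have "continuous_on UNIV (\<lambda>z. G (z - E z))"
      by (intro continuous_on_compose2[OF G(1)] continuous_intros) auto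
    moreover have "continuous_on UNIV (\<lambda>z. scaleCx (inverse (c - t)) (E z))"
      by (rule bounded_linear.continuous_on[OF bounded_linear_scaleCx E_cont])
    ultimately show ?thesis unfolding H_def[abs_def] by (rule continuous_on_add)
  qed
  ultimately show ?thesis unfolding not_in_spectrum_iff B_def by blast
qed

section \<open>Inverting \<open>1 - Q\<close> when some power of \<open>Q\<close> is a strict
  contraction\<close>

lemma bounded_linear_funpow:
  fixes Q :: "'a::real_normed_vector \<Rightarrow> 'a"
  assumes "bounded_linear Q"
  shows "bounded_linear (Q ^^ n)"
proof (induction n)
  case 0
  then show ?case by (simp add: id_def bounded_linear_ident)
next
  case (Suc n)
  then show ?case using bounded_linear_compose[OF assms] by (simp add: o_def)
qed

text \<open>\<open>V y\<close> is the fixed point of the contraction sending \<open>x\<close> to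
  \<open>y + R x\<close>, which exists by completeness. Uniqueness of the fixed point makes
  \<open>V\<close> linear; solving \<open>norm (V y) \<le> norm y + onorm R * norm (V y)\<close>
  gives the bound.\<close>

lemma contraction_perturbation_inverse:
  fixes R :: "'a::banach \<Rightarrow> 'a"
  assumes R: "bounded_linear R" and less: "onorm R < 1"
  obtains V where "bounded_linear V" "\<And>y. V y - R (V y) = y"
proof -
  interpret R: bounded_linear R by fact
  have ge: "0 \<le> onorm R" by (rule onorm_pos_le[OF R])
  have "\<exists>!x. y + R x = x" for y
  proof (rule banach_fix_type[OF ge less], intro allI)
    fix x x'
    have "norm (R (x - x')) \<le> onorm R * norm (x - x')" by (rule onorm[OF R])
    then show "dist (y + R x) (y + R x') \<le> onorm R * dist x x'"
      by (simp add: dist_norm R.diff)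
  qed
  then have ex1: "\<exists>!x. x - R x = y" for y
    by (simp only: diff_eq_eq eq_commute[of _ "y + R _"])
  then obtain V where V: "\<And>y. V y - R (V y) = y" by metis
  have uniq: "V y = x" if "x - R x = y" for x y using ex1 V that by metis
  have "bounded_linear V"
  proof (rule bounded_linear_intro[where K = "1 / (1 - onorm R)"])
    show "V (x + y) = V x + V y" for x y
      by (rule uniq) (metis R.add V add_diff_add)
    show "V (r *\<^sub>R x) = r *\<^sub>R V x" for r x
      by (rule uniq) (metis R.scaleR V scaleR_diff_right)
    show "norm (V y) \<le> norm y * (1 / (1 - onorm R))" for y
    proof -
      have "norm (V y) \<le> norm y + norm (R (V y))"
        using norm_triangle_ineq[of y "R (V y)"] V[of y] by (metis diff_add_cancel)
      also have "\<dots> \<le> norm y + onorm R * norm (V y)" using onorm[OF R] by simp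
      finally show ?thesis using less by (simp add: field_simps)
    qed
  qed
  with V show ?thesis using that by blast
qed

text \<open>From \<open>1 - Q^N = (1 - Q) (1 + Q + ... + Q^(N-1))\<close>, a right inverse of
  \<open>1 - Q\<close> is the finite geometric sum applied after the inverse \<open>V\<close> of
  \<open>1 - Q^N\<close>.\<close>

lemma power_contraction_inverse:
  fixes Q :: "'a::banach \<Rightarrow> 'a"
  assumes Q: "bounded_linear Q" and less: "onorm (Q ^^ N) < 1"
  obtains S where "bounded_linear S" "\<And>y. S y - Q (S y) = y" "\<And>x. S (x - Q x) = x"
proof -
  interpret Q: bounded_linear Q by fact
  have QN: "bounded_linear (Q ^^ N)" by (rule bounded_linear_funpow[OF Q])
  obtain V where V: "bounded_linear V" "\<And>y. V y - (Q ^^ N) (V y) = y"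
    using contraction_perturbation_inverse[OF QN less] by blast
  define S where "S y = (\<Sum>i<N. (Q ^^ i) (V y))" for y
  have "bounded_linear S"
    unfolding S_def[abs_def]
    by (intro bounded_linear_sum bounded_linear_compose[OF bounded_linear_funpow[OF Q] V(1)])
  moreover have right: "S y - Q (S y) = y" for y
  proof -
    have "S y - Q (S y) = (\<Sum>i<N. (Q ^^ i) (V y) - (Q ^^ Suc i) (V y))"
      by (simp add: S_def Q.sum sum_subtractf)
    also have "\<dots> = V y - (Q ^^ N) (V y)"
      by (subst sum_lessThan_telescope') simp
    finally show ?thesis by (simp add: V(2))
  qed
  moreover have "S (x - Q x) = x" for x
  proof -
    \<comment> \<open>The left inverse property comes from injectivity: the defect \<open>d\<close>
      is fixed by \<open>Q\<close>, hence by the strict contraction \<open>Q ^^ N\<close>, and so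
      vanishes.\<close>
    define d where "d = S (x - Q x) - x"
    have "Q d = d" using right[of "x - Q x"] by (simp add: d_def Q.diff algebra_simps)
    then have "(Q ^^ n) d = d" for n by (induction n) simp_all
    then have "norm d \<le> onorm (Q ^^ N) * norm d" using onorm[OF QN, of d] by simp
    then have "(1 - onorm (Q ^^ N)) * norm d \<le> 0" by (simp add: algebra_simps)
    with less have "d = 0" by (simp add: mult_le_0_iff)
    then show ?thesis by (simp add: d_def)
  qed
  ultimately show ?thesis using that by blast
qed

text \<open>The point 1 is real, so \<open>1 - Q\<close> acts separately on real and imaginary parts
  and its real inverse \<open>S\<close> can be complexified.\<close>

lemma one_not_in_spectrum:
  fixes Q :: "'a::banach \<Rightarrow> 'a"
  assumes "bounded_linear Q" and "onorm (Q ^^ N) < 1"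
  shows "1 \<notin> spectrum Q"
proof -
  obtain S where S: "bounded_linear S" "\<And>y. S y - Q (S y) = y" "\<And>x. S (x - Q x) = x"
    using power_contraction_inverse[OF assms] by blast
  have "continuous_on UNIV (complexify S)"
    by (rule bounded_linear.continuous_on[OF bounded_linear_complexify[OF S(1)] continuous_on_id])
  moreover have "scaleCx 1 (complexify S z) - complexify Q (complexify S z) = z" for z
    by (auto intro!: complexification_eqI simp: S(2))
  moreover have "complexify S (scaleCx 1 z - complexify Q z) = z" for z
    by (auto intro!: complexification_eqI simp: S(3))
  ultimately show ?thesis unfolding not_in_spectrum_iff by blast
qed

text \<open>The spectra will be compared only away from 0. If nothing else is left, the convention
  for the empty set supplies the value 0; otherwise a positive element remains and dominates
  0.\<close>

lemma nonneg_Sup_remove_0: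
  assumes "\<And>x. x \<in> A \<Longrightarrow> 0 \<le> x"
  shows "nonneg_Sup (A - {0}) = nonneg_Sup A"
proof (cases "A - {0} = {}")
  case True
  then consider "A = {}" | "A = {0}" by blast
  then show ?thesis by cases (simp_all add: nonneg_Sup_def)
next
  case False
  then obtain a where a: "a \<in> A" "a \<noteq> 0" by blast
  have "0 \<le> z" if "\<forall>x\<in>A - {0}. x \<le> z" for z
    using a assms[of a] that by (meson DiffI order_trans singletonD)
  \<comment> \<open>Real \<open>Sup\<close> is defined as the least upper bound, so equal sets of
    upper bounds give equal values, bounded or not.\<close>
  then have "(\<forall>x\<in>A - {0}. x \<le> z) \<longleftrightarrow> (\<forall>x\<in>A. x \<le> z)" for z by blast
  then have "Sup (A - {0}) = Sup A" by (simp only: Sup_real_def)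
  with False show ?thesis by (auto simp: nonneg_Sup_def)
qed


section \<open>Markov operators\<close>

lemma (in abstract_state_space) scaled_base:
  assumes "0 \<le> x" "x \<noteq> 0"
  shows "0 < f x" "(1 / f x) *\<^sub>R x \<in> state_base f"
proof -
  show pos: "0 < f x" using strictly_positive assms by blast
  then show "(1 / f x) *\<^sub>R x \<in> state_base f"
    using assms(1) linear_scale[OF linear_functional]
    by (simp add: state_base_def scaleR_nonneg_nonneg)
qed

lemma (in abstract_state_space) base_nonempty: "state_base f \<noteq> {}"
proof -
  obtain x :: 'a where "x \<noteq> 0" using nontrivial by blast
  moreover obtain y z where "0 \<le> y" "0 \<le> z" "x = y - z" using generating by blast
  ultimately obtain w :: 'a where "0 \<le> w" "w \<noteq> 0" by (cases "y = 0") auto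
  then show ?thesis using scaled_base(2) by blast
qed

lemma (in abstract_state_space) cone_decomp:
  assumes "0 \<le> x"
  obtains k where "k \<in> state_base f" "x = f x *\<^sub>R k" "0 \<le> f x"
proof (cases "x = 0")
  case True
  then show ?thesis using base_nonempty that linear_0[OF linear_functional] by auto
next
  case False
  then show ?thesis using scaled_base[OF assms] that[of "(1 / f x) *\<^sub>R x"] by simp
qed

text \<open>Makes the infimum in \<open>base_seminorm\<close> one over a nonempty set. For
  \<open>x = y - z\<close> the scale \<open>f y + f z\<close> works, since dividing by it turns
  \<open>x\<close> into a convex combination of a base point and a negated base point.\<close>

lemma (in abstract_state_space) absorbing:
  "\<exists>l\<ge>0. x \<in> (\<lambda>u. l *\<^sub>R u) ` base_ball f"
proof -
  obtain y z where yz: "0 \<le> y" "0 \<le> z" "x = y - z" using generating by blast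
  obtain k where k: "k \<in> state_base f" "y = f y *\<^sub>R k" "0 \<le> f y" using cone_decomp[OF yz(1)] .
  obtain m where m: "m \<in> state_base f" "z = f z *\<^sub>R m" "0 \<le> f z" using cone_decomp[OF yz(2)] .
  have kU: "k \<in> base_ball f" and mU: "- m \<in> base_ball f"
    using k(1) m(1) by (auto simp: base_ball_def intro: hull_inc)
  define l where "l = f y + f z"
  show ?thesis
  proof (cases "l = 0")
    case True
    then have "f y = 0" "f z = 0" using k(3) m(3) by (auto simp: l_def)
    then have "x = 0 *\<^sub>R k" using k(2) m(2) yz(3) by simp
    then show ?thesis using kU by (intro exI[of _ 0]) (simp add: image_iff, blast)
  next
    case False
    then have l: "l > 0" using k(3) m(3) by (simp add: l_def)
    have sum: "f y / l + f z / l = 1" using l by (simp add: l_def flip: add_divide_distrib)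
    have "(f y / l) *\<^sub>R k + (f z / l) *\<^sub>R (- m) \<in> base_ball f"
      unfolding base_ball_def
      by (rule convexD[OF convex_convex_hull _ _ _ _ sum])
        (use kU mU k(3) m(3) l in \<open>simp_all add: base_ball_def\<close>)
    moreover have "l *\<^sub>R ((f y / l) *\<^sub>R k + (f z / l) *\<^sub>R (- m)) = f y *\<^sub>R k - f z *\<^sub>R m"
      using l by (simp add: scaleR_diff_right)
    then have "x = l *\<^sub>R ((f y / l) *\<^sub>R k + (f z / l) *\<^sub>R (- m))"
      using yz(3) by (simp only: k(2)[symmetric] m(2)[symmetric])
    ultimately show ?thesis using l by (intro exI[of _ l]) auto
  qed
qed

lemma markov_base_ball:
  assumes "markov_operator f T"
  shows "T ` base_ball f \<subseteq> base_ball f"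
proof -
  have lin: "linear T" and base: "T ` state_base f \<subseteq> state_base f"
    using assms by (auto simp: markov_operator_def)
  have "T ` base_ball f = convex hull (T ` (state_base f \<union> uminus ` state_base f))"
    unfolding base_ball_def by (rule convex_hull_linear_image[OF lin])
  also have "\<dots> \<subseteq> base_ball f"
    unfolding base_ball_def
    using base by (intro hull_mono) (auto simp: linear_neg[OF lin])
  finally show ?thesis .
qed

text \<open>Since \<open>T\<close> maps the ball into itself, every scale admissible for
  \<open>x\<close> is admissible for \<open>T x\<close>, and the infimum over the larger set is
  smaller.\<close>

lemma (in abstract_state_space) markov_contraction:
  assumes "markov_operator f T"
  shows "norm (T x) \<le> norm x"
proof -
  have lin: "linear T" using assms by (simp add: markov_operator_def)
  have "x \<in> (\<lambda>u. l *\<^sub>R u) ` base_ball f \<Longrightarrow> T x \<in> (\<lambda>u. l *\<^sub>R u) ` base_ball f" for l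
    using markov_base_ball[OF assms] by (fastforce simp: linear_scale[OF lin])
  then have "base_seminorm f (T x) \<le> base_seminorm f x"
    unfolding base_seminorm_def using absorbing[of x]
    by (intro cInf_superset_mono) (auto intro: bdd_belowI[where m = 0])
  then show ?thesis by (simp add: norm_eq)
qed

lemma (in abstract_state_space) markov_bounded_linear:
  assumes "markov_operator f T"
  shows "bounded_linear T"
  using assms markov_contraction[OF assms]
  by (intro bounded_linear_intro[where K = 1])
    (auto simp: markov_operator_def linear_add linear_scale)


section \<open>Uniform ergodicity\<close>

lemma uniformly_ergodic_tendsto:
  assumes T: "bounded_linear T" and P: "bounded_linear P" and erg: "uniformly_ergodic T P"
  shows "(\<lambda>n. (T ^^ n) x) \<longlonglongrightarrow> P x"
proof -
  have "(\<lambda>n. (T ^^ n) x - P x) \<longlonglongrightarrow> 0"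
  proof (rule Lim_null_comparison)
    show "\<forall>\<^sub>F n in sequentially.
        norm ((T ^^ n) x - P x) \<le> onorm (\<lambda>x. (T ^^ n) x - P x) * norm x"
      by (intro always_eventually allI onorm bounded_linear_sub bounded_linear_funpow T P)
    show "(\<lambda>n. onorm (\<lambda>x. (T ^^ n) x - P x) * norm x) \<longlonglongrightarrow> 0"
      using erg unfolding uniformly_ergodic_def by (rule tendsto_mult_left_zero)
  qed
  then show ?thesis by (rule LIM_zero_cancel)
qed

text \<open>Write \<open>T^(n+1) x\<close> once as \<open>T (T^n x)\<close> and once as
  \<open>T^n (T x)\<close>; both tend to \<open>P x\<close>, while the two forms have limits
  \<open>T (P x)\<close> and \<open>P (T x)\<close>.\<close>

lemma uniformly_ergodic_absorb:
  assumes T: "bounded_linear T" and P: "bounded_linear P" and erg: "uniformly_ergodic T P"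
  shows "T (P x) = P x" "P (T x) = P x"
proof -
  note lim = uniformly_ergodic_tendsto[OF assms]
  have Suc: "(\<lambda>n. (T ^^ Suc n) x) \<longlonglongrightarrow> P x" using lim by (rule LIMSEQ_Suc)
  have "(\<lambda>n. T ((T ^^ n) x)) \<longlonglongrightarrow> T (P x)" by (rule bounded_linear.tendsto[OF T lim])
  with Suc show "T (P x) = P x" by (intro LIMSEQ_unique[OF _ Suc]) simp
  have "(\<lambda>n. (T ^^ Suc n) x) \<longlonglongrightarrow> P (T x)" using lim[of "T x"] by (simp only: funpow_Suc_right o_apply)
  then show "P (T x) = P x" by (rule LIMSEQ_unique[OF _ Suc])
qed

section \<open>Comparison of the spectra of \<open>T\<close> and \<open>T - P\<close>\<close>

lemma uniformly_ergodic_spectrum: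
  fixes T P :: "'a::banach \<Rightarrow> 'a"
  assumes T: "bounded_linear T" and P: "bounded_linear P" and PP: "P \<circ> P = P"
    and erg: "uniformly_ergodic T P"
  shows "spectrum (\<lambda>x. T x - P x) - {0} = spectrum T - {0, 1}"
proof -
  define Q where "Q x = T x - P x" for x
  interpret T: bounded_linear T by fact
  interpret P: bounded_linear P by fact
  have Q: "bounded_linear Q" unfolding Q_def[abs_def] by (rule bounded_linear_sub[OF T P])
  then interpret Q: bounded_linear Q .
  note absorb = uniformly_ergodic_absorb[OF T P erg]
  have idem: "P (P x) = P x" for x using PP by (metis o_apply)
  have QP: "Q (P x) = 0" and PQ: "P (Q x) = 0" for x
    by (simp_all add: Q_def absorb idem P.diff)
  \<comment> \<open>Stated from exponent 1 on: at exponent 0 the left side would be \<open>x\<close>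
    and the right side \<open>x - P x\<close>.\<close>
  have power: "(Q ^^ Suc n) x = (T ^^ Suc n) x - P x" for n x
  proof (induction n)
    case (Suc n)
    have "(T ^^ k) (P x) = P x" and "P ((T ^^ k) x) = P x" for k
      by (induction k) (simp_all add: absorb)
    with Suc show ?case by (simp add: Q_def T.diff P.diff absorb idem)
  qed (simp add: Q_def)
  have "Q ^^ Suc n = (\<lambda>x. (T ^^ Suc n) x - P x)" for n
    by (rule ext) (rule power)
  then have "(\<lambda>n. onorm (Q ^^ Suc n)) \<longlonglongrightarrow> 0"
    using LIMSEQ_Suc[OF erg[unfolded uniformly_ergodic_def]] by (simp only:)
  then have "\<forall>\<^sub>F n in sequentially. onorm (Q ^^ Suc n) < 1" by (rule order_tendstoD) simp
  then obtain N where "onorm (Q ^^ N) < 1" by (auto simp only: eventually_sequentially)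
  then have one: "1 \<notin> spectrum Q" by (rule one_not_in_spectrum[OF Q])
  have "c \<in> spectrum Q \<longleftrightarrow> c \<in> spectrum T" if c: "c \<noteq> 0" "c \<noteq> 1" for c
  proof -
    \<comment> \<open>On the range of \<open>P\<close> the operator \<open>Q\<close> is 0 and
      \<open>T\<close> is the identity, whence the scalars 0 and 1, exchanged for the
      converse.\<close>
    have "c \<notin> spectrum Q \<Longrightarrow> c \<notin> spectrum T"
      by (rule not_in_spectrum_transfer[OF Q.linear T.linear P, where s = 0 and t = 1])
        (use c in \<open>simp_all add: idem absorb QP PQ, simp add: Q_def\<close>)
    moreover have "c \<notin> spectrum T \<Longrightarrow> c \<notin> spectrum Q"
      by (rule not_in_spectrum_transfer[OF T.linear Q.linear P, where s = 1 and t = 0])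
        (use c in \<open>simp_all add: idem absorb QP PQ, simp add: Q_def\<close>)
    ultimately show ?thesis by blast
  qed
  with one show ?thesis unfolding Q_def[abs_def] by blast
qed

theorem theorem3p7:
  fixes f :: "'a::{ordered_real_vector,banach} \<Rightarrow> real"
    and T P :: "'a \<Rightarrow> 'a"
  assumes "abstract_state_space f"
    and "markov_operator f T"
    and "bounded_projection P"
    and "uniformly_ergodic T P"
  shows "beta_star T = spectral_radius (\<lambda>x. T x - P x)"
proof -
  have T: "bounded_linear T"
    using abstract_state_space.markov_bounded_linear assms(1,2) by blast
  have P: "bounded_linear P" "P \<circ> P = P"
    using assms(3) by (simp_all add: bounded_projection_def)
  note spec = uniformly_ergodic_spectrum[OF T P assms(4)]
  define A where "A = {cmod c | c. c \<in> spectrum T \<and> c \<noteq> 1}"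
  define B where "B = {cmod c | c. c \<in> spectrum (\<lambda>x. T x - P x)}"
  \<comment> \<open>Only \<open>c = 0\<close> has modulus 0, so dropping the modulus 0 is the same
    as dropping the spectral point 0.\<close>
  have "A - {0} = cmod ` (spectrum T - {0, 1})" by (auto simp: A_def)
  moreover have "B - {0} = cmod ` (spectrum (\<lambda>x. T x - P x) - {0})" by (auto simp: B_def)
  ultimately have "A - {0} = B - {0}" by (simp only: spec)
  moreover have "nonneg_Sup (A - {0}) = nonneg_Sup A"
    by (rule nonneg_Sup_remove_0) (auto simp: A_def)
  moreover have "nonneg_Sup (B - {0}) = nonneg_Sup B"
    by (rule nonneg_Sup_remove_0) (auto simp: B_def)
  ultimately show ?thesis by (simp add: beta_star_def spectral_radius_def A_def B_def)
qed

end
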